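(* Let $f$ be a uniformly continuous surjective map on a metric space $(X,d)$. If $f$ has two distinct specification points, then $f$ has positive Bowen entropy, i.e. $h(f)>0$.
   Context: Specification point: let $f$ be a continuous map on a metric space $(X,d)$ and $x\in X$. Then $x$ is a specification point of $f$ if for every $\epsilon>0$ there is a positive integer $M(\epsilon)$ such that for any finite sequence $x=x_1,x_2,\dots,x_k$ in $X$ (whose first term is $x$) and any integers $0\le a_1\le b_1<a_2\le b_2<\dots<a_k\le b_k$ with $a_j-b_{j-1}\ge M(\epsilon)$ for all $2\le j\le k$, there is $y\in X$ with $d(f^i(y),f^i(x_j))<\epsilon$ for all $a_j\le i\le b_j$ and all $1\le j\le k$. Bowen entropy: let $f$ be a uniformly continuous surjective map on $(X,d)$ and let $\mathcal{K}(X)$ be the set of all compact subsets of $X$. For a positive integer $n$ put $d_n(x,y)=\max_{0\le i\le n-1}d(f^i(x),f^i(y))$. For $\epsilon>0$ and $K\in\mathcal{K}(X)$, a subset $F\subset K$ is $(n,\epsilon)$-separated if $d_n(x,y)>\epsilon$ for every pair of distinct points $x,y\in F$; $s_n(\epsilon,K)$ is the largest cardinality of an $(n,\epsilon)$-separated subset of $K$; $s(\epsilon,K)=\limsup_{n\to\infty}\frac1n\log s_n(\epsilon,K)$; and $h(f)=\sup_{K\in\mathcal{K}(X)}\lim_{\epsilon\to0}s(\epsilon,K)$. *)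

theory Defs
  imports "HOL-Analysis.Analysis"
begin

(* The orbit segment of u j is shadowed at the absolute times a j, ..., b j, i.e. f^i y is
   compared with f^i (u j), not with f^(i - a j) (u j). *)
definition specification_point :: "('a::metric_space \<Rightarrow> 'a) \<Rightarrow> 'a \<Rightarrow> bool" where
  "specification_point f x \<longleftrightarrow>
     (\<forall>\<epsilon>>0. \<exists>M::nat. M > 0 \<and>
       (\<forall>k\<ge>1. \<forall>u :: nat \<Rightarrow> 'a. \<forall>a b :: nat \<Rightarrow> nat.
          u 1 = x \<longrightarrow>
          (\<forall>j\<in>{1..k}. a j \<le> b j) \<longrightarrow>
          (\<forall>j\<in>{2..k}. b (j - 1) < a j \<and> a j - b (j - 1) \<ge> M) \<longrightarrow>
          (\<exists>y. \<forall>j\<in>{1..k}. \<forall>i\<in>{a j..b j}. dist ((f ^^ i) y) ((f ^^ i) (u j)) < \<epsilon>)))"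

definition bowen_dist :: "('a::metric_space \<Rightarrow> 'a) \<Rightarrow> nat \<Rightarrow> 'a \<Rightarrow> 'a \<Rightarrow> real" where
  "bowen_dist f n x y = Max ((\<lambda>i. dist ((f ^^ i) x) ((f ^^ i) y)) ` {0..n - 1})"

definition separated ::
  "('a::metric_space \<Rightarrow> 'a) \<Rightarrow> nat \<Rightarrow> real \<Rightarrow> 'a set \<Rightarrow> 'a set \<Rightarrow> bool" where
  "separated f n \<epsilon> K F \<longleftrightarrow>
     F \<subseteq> K \<and> (\<forall>x\<in>F. \<forall>y\<in>F. x \<noteq> y \<longrightarrow> bowen_dist f n x y > \<epsilon>)"

(* For continuous f, compact K and \<epsilon> > 0 all separated sets are finite and their cardinalities
   are bounded (lemmas below), so the maximum is attained. *)
definition sep_num :: "('a::metric_space \<Rightarrow> 'a) \<Rightarrow> nat \<Rightarrow> real \<Rightarrow> 'a set \<Rightarrow> nat" where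
  "sep_num f n \<epsilon> K = Max (card ` {F. separated f n \<epsilon> K F})"

(* Extended-real valued: the growth rate may be infinite when the space is not compact.
   Since ln 0 = 0, the empty compact set gets rate 0 instead of -\<infinity>; this does not affect
   bowen_entropy, because any singleton has rate 0 as well. *)
definition sep_rate :: "('a::metric_space \<Rightarrow> 'a) \<Rightarrow> real \<Rightarrow> 'a set \<Rightarrow> ereal" where
  "sep_rate f \<epsilon> K = limsup (\<lambda>n. ereal (1 / real n * ln (real (sep_num f n \<epsilon> K))))"

definition bowen_entropy :: "('a::metric_space \<Rightarrow> 'a) \<Rightarrow> ereal" where
  "bowen_entropy f = (SUP K\<in>{K. compact K}. Lim (at_right 0) (\<lambda>\<epsilon>. sep_rate f \<epsilon> K))"

lemma bowen_dist_gt_iff: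
  "bowen_dist f n x y > e \<longleftrightarrow> (\<exists>i\<le>n - 1. dist ((f ^^ i) x) ((f ^^ i) y) > e)"
  unfolding bowen_dist_def by (subst Max_gr_iff) auto

lemma separated_bounded:
  fixes f :: "'a::metric_space \<Rightarrow> 'a"
  assumes f: "continuous_on UNIV f" and K: "compact K" and e: "\<epsilon> > 0"
  obtains N where "\<And>F. separated f n \<epsilon> K F \<Longrightarrow> finite F \<and> card F \<le> N"
proof -
  have cont: "continuous_on UNIV (f ^^ i)" for i
  proof (induction i)
    case (Suc i)
    then show ?case
      using continuous_on_compose[OF Suc continuous_on_subset[OF f]] by (simp add: o_def)
  qed (simp add: id_def)
  define U where "U c = (\<Inter>i\<in>{0..n - 1}. {z. dist ((f ^^ i) c) ((f ^^ i) z) < \<epsilon> / 2})" for c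
  have op: "open (U c)" for c
    unfolding U_def
    by (intro open_INT ballI open_Collect_less continuous_intros cont) auto
  have "K \<subseteq> (\<Union>c\<in>K. U c)"
    using e by (auto simp: U_def)
  then obtain C where C: "C \<subseteq> K" "finite C" "K \<subseteq> (\<Union>c\<in>C. U c)"
    using compactE_image[OF K, of K U] op by metis
  have "finite F \<and> card F \<le> card C" if F: "separated f n \<epsilon> K F" for F
  proof -
    have "\<forall>x\<in>F. \<exists>c\<in>C. x \<in> U c"
      using F C by (auto simp: separated_def)
    then obtain g where g: "\<And>x. x \<in> F \<Longrightarrow> g x \<in> C \<and> x \<in> U (g x)"
      by metis
    have "inj_on g F"
    proof (rule inj_onI, rule ccontr)
      fix x y assume xy: "x \<in> F" "y \<in> F" "g x = g y" "x \<noteq> y"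
      then have "bowen_dist f n x y > \<epsilon>"
        using F by (auto simp: separated_def)
      then obtain i where i: "i \<le> n - 1" "dist ((f ^^ i) x) ((f ^^ i) y) > \<epsilon>"
        unfolding bowen_dist_gt_iff by blast
      have "dist ((f ^^ i) (g x)) ((f ^^ i) x) < \<epsilon> / 2" "dist ((f ^^ i) (g x)) ((f ^^ i) y) < \<epsilon> / 2"
        using g[of x] g[of y] xy i by (auto simp: U_def)
      then show False
        using i dist_triangle_half_r by (metis less_asym)
    qed
    moreover have "g ` F \<subseteq> C"
      using g by auto
    ultimately show ?thesis
      using C(2) by (meson card_inj_on_le inj_on_finite)
  qed
  then show ?thesis
    using that by blast
qed

lemma sep_num_attained:
  fixes f :: "'a::metric_space \<Rightarrow> 'a"
  assumes f: "continuous_on UNIV f" and K: "compact K" and e: "\<epsilon> > 0"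
  shows "\<exists>F. separated f n \<epsilon> K F \<and> finite F \<and> card F = sep_num f n \<epsilon> K"
    and "separated f n \<epsilon> K F \<Longrightarrow> finite F \<and> card F \<le> sep_num f n \<epsilon> K"
proof -
  obtain N where N: "\<And>F. separated f n \<epsilon> K F \<Longrightarrow> finite F \<and> card F \<le> N"
    using separated_bounded[OF assms] by metis
  have fin: "finite (card ` {F. separated f n \<epsilon> K F})"
    by (rule finite_subset[of _ "{..N}"]) (use N in auto)
  have ne: "separated f n \<epsilon> K {}"
    by (simp add: separated_def)
  have "sep_num f n \<epsilon> K \<in> card ` {F. separated f n \<epsilon> K F}"
    unfolding sep_num_def using fin ne by (intro Max_in) auto
  then show "\<exists>F. separated f n \<epsilon> K F \<and> finite F \<and> card F = sep_num f n \<epsilon> K"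
    using N by auto
  show "separated f n \<epsilon> K F \<Longrightarrow> finite F \<and> card F \<le> sep_num f n \<epsilon> K"
    unfolding sep_num_def using fin N by (auto intro: Max_ge)
qed

lemma sep_num_antimono:
  fixes f :: "'a::metric_space \<Rightarrow> 'a"
  assumes f: "continuous_on UNIV f" and K: "compact K" and e: "0 < \<epsilon>" "\<epsilon> \<le> \<delta>"
  shows "sep_num f n \<delta> K \<le> sep_num f n \<epsilon> K"
proof -
  obtain F where F: "separated f n \<delta> K F" "card F = sep_num f n \<delta> K"
    using sep_num_attained(1)[OF f K, of \<delta> n] e by auto
  then have "separated f n \<epsilon> K F"
    using e by (fastforce simp: separated_def)
  then show ?thesis
    using sep_num_attained(2)[OF f K e(1)] F by metis
qed

lemma sep_rate_antimono:
  fixes f :: "'a::metric_space \<Rightarrow> 'a"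
  assumes f: "continuous_on UNIV f" and K: "compact K" and e: "0 < \<epsilon>" "\<epsilon> \<le> \<delta>"
  shows "sep_rate f \<delta> K \<le> sep_rate f \<epsilon> K"
  unfolding sep_rate_def
proof (intro Limsup_mono always_eventually allI)
  fix n
  have "ln (real (sep_num f n \<delta> K)) \<le> ln (real (sep_num f n \<epsilon> K))"
    using sep_num_antimono[OF assms, of n]
    by (cases "sep_num f n \<delta> K = 0"; cases "sep_num f n \<epsilon> K = 0") auto
  then show "ereal (1 / real n * ln (real (sep_num f n \<delta> K)))
      \<le> ereal (1 / real n * ln (real (sep_num f n \<epsilon> K)))"
    by (simp add: divide_right_mono)
qed

(* The limit in the definition of bowen_entropy exists, by monotonicity in \<epsilon>. *)
lemma sep_rate_tendsto:
  fixes f :: "'a::metric_space \<Rightarrow> 'a"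
  assumes f: "continuous_on UNIV f" and K: "compact K"
  shows "((\<lambda>\<epsilon>. sep_rate f \<epsilon> K) \<longlongrightarrow> (SUP \<epsilon>\<in>{0<..}. sep_rate f \<epsilon> K)) (at_right 0)"
proof (rule order_tendstoI)
  fix c assume "c < (SUP \<epsilon>\<in>{0<..}. sep_rate f \<epsilon> K)"
  then obtain d where d: "d > 0" "c < sep_rate f d K"
    by (auto simp: less_SUP_iff)
  have "eventually (\<lambda>\<epsilon>. \<epsilon> \<in> {0<..<d}) (at_right (0::real))"
    using d by (intro eventually_at_right_real)
  then show "eventually (\<lambda>\<epsilon>. c < sep_rate f \<epsilon> K) (at_right 0)"
    by eventually_elim
      (use d sep_rate_antimono[OF f K] in \<open>force intro: less_le_trans\<close>)
next
  fix c assume c: "(SUP \<epsilon>\<in>{0<..}. sep_rate f \<epsilon> K) < c"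
  have le: "sep_rate f \<epsilon> K < c" if "0 < \<epsilon>" for \<epsilon>
  proof -
    have "sep_rate f \<epsilon> K \<le> (SUP \<epsilon>\<in>{0<..}. sep_rate f \<epsilon> K)"
      using that by (intro SUP_upper) auto
    then show ?thesis
      using c by (rule le_less_trans)
  qed
  show "eventually (\<lambda>\<epsilon>. sep_rate f \<epsilon> K < c) (at_right 0)"
    using eventually_at_right_less[of 0] by eventually_elim (rule le)
qed

end

theory Submission
  imports Defs
begin

text \<open>
  A specification point \<open>x\<close> and a second point \<open>y\<close> give arbitrarily long orbits that pass near
  \<open>x\<close> or near \<open>y\<close> at prescribed times.  At a fixed precision the times can be taken in an
  arithmetic progression of fixed step \<open>M\<close>, so \<open>2 ^ L\<close> orbits, one for each subset of
  \<open>{1..L}\<close>, get separated by time \<open>L * M\<close>: this is exponential growth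
  (\<open>specification_point_code\<close>).

  The difficulty is that the space need not be compact, nor complete, while entropy only counts
  separated points inside one fixed compact set.  Better control of the starting points costs a
  longer gap, and using the finer precision throughout would destroy the growth rate.  The remedy
  is to specify twice.  The coded orbits are built first, with the coarse precision and its short
  gap; then each of them is shadowed as a single block by an orbit that starts within \<open>\<delta>\<close> of
  \<open>x\<close> (\<open>specification_point_block\<close>).  The long gap belonging to \<open>\<delta>\<close> is paid only once, and
  becomes negligible when \<open>L\<close> is large (\<open>specification_point_separated_near\<close>).

  For \<open>\<delta> = 1, 1/2, 1/3, \<dots>\<close> this yields finite sets shrinking to \<open>x\<close>.  Their union together with
  \<open>x\<close> is compact (\<open>compact_insert_shrinking\<close>), and it contains exponentially many separated
  points for infinitely many orbit lengths, with a growth rate that is independent of \<open>\<delta>\<close>.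
\<close>

section \<open>Countable compact sets with one limit point\<close>

text \<open>An open set around \<open>x\<close> already covers all but finitely many of the finite sets.\<close>

lemma compact_insert_shrinking:
  fixes x :: "'a::metric_space"
  assumes fin: "\<And>k. finite (F k)"
    and shrink: "\<And>r. r > 0 \<Longrightarrow> \<forall>\<^sub>F k in sequentially. F k \<subseteq> ball x r"
  shows "compact (insert x (\<Union>k. F k))"
  unfolding compact_eq_Heine_Borel
proof (intro allI impI)
  fix C assume C: "(\<forall>U\<in>C. open U) \<and> insert x (\<Union>k. F k) \<subseteq> \<Union>C"
  then obtain U where U: "U \<in> C" "x \<in> U" "open U"
    by blast
  then obtain r where r: "r > 0" "ball x r \<subseteq> U"
    using openE by blast
  obtain N where N: "\<And>k. k \<ge> N \<Longrightarrow> F k \<subseteq> U"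
    using shrink[OF r(1)] r(2) unfolding eventually_sequentially by blast
  have "compact (\<Union>k<N. F k)"
    using fin by (intro finite_imp_compact) auto
  moreover have "(\<Union>k<N. F k) \<subseteq> \<Union>C"
    using C by blast
  ultimately obtain D where D: "D \<subseteq> C" "finite D" "(\<Union>k<N. F k) \<subseteq> \<Union>D"
    using C unfolding compact_eq_Heine_Borel by meson
  have "z \<in> \<Union>(insert U D)" if "z \<in> F k" for z k
    using that N[of k] D(3) by (cases "k < N") (auto simp: not_less)
  then have "insert x (\<Union>k. F k) \<subseteq> \<Union>(insert U D)"
    using U by blast
  then show "\<exists>D\<subseteq>C. finite D \<and> insert x (\<Union>k. F k) \<subseteq> \<Union>D"
    using D U by (intro exI[of _ "insert U D"]) auto
qed

section \<open>Lower bounds for Bowen entropy\<close>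

lemma sep_rate_le_bowen_entropy:
  fixes f :: "'a::metric_space \<Rightarrow> 'a"
  assumes f: "continuous_on UNIV f" and K: "compact K" and e: "\<epsilon> > 0"
  shows "sep_rate f \<epsilon> K \<le> bowen_entropy f"
proof -
  have "sep_rate f \<epsilon> K \<le> (SUP \<epsilon>\<in>{0<..}. sep_rate f \<epsilon> K)"
    using e by (intro SUP_upper) auto
  also have "\<dots> = Lim (at_right 0) (\<lambda>\<epsilon>. sep_rate f \<epsilon> K)"
    using tendsto_Lim[OF trivial_limit_at_right_real sep_rate_tendsto[OF f K]] by simp
  also have "\<dots> \<le> bowen_entropy f"
    unfolding bowen_entropy_def using K by (intro SUP_upper) auto
  finally show ?thesis .
qed

text \<open>
  The growth rate is an upper limit, so unboundedly many orbit lengths suffice.  This is what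
  lets the compact set be assembled from finite sets that each serve a single length.
\<close>

lemma bowen_entropy_ge:
  fixes f :: "'a::metric_space \<Rightarrow> 'a"
  assumes f: "continuous_on UNIV f" and K: "compact K" and e: "\<epsilon> > 0"
    and many: "\<And>m. \<exists>n\<ge>m. \<exists>F. n > 0 \<and> separated f n \<epsilon> K F \<and> real n * c \<le> ln (real (card F))"
  shows "ereal c \<le> bowen_entropy f"
proof -
  have "\<exists>n\<ge>m. ereal c \<le> ereal (1 / real n * ln (real (sep_num f n \<epsilon> K)))" for m
  proof -
    obtain n F where n: "n \<ge> m" "n > 0" and F: "separated f n \<epsilon> K F"
      and le: "real n * c \<le> ln (real (card F))"
      using many by metis
    have "card F \<le> sep_num f n \<epsilon> K"
      using sep_num_attained(2)[OF f K e F] by simp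
    then have "ln (real (card F)) \<le> ln (real (sep_num f n \<epsilon> K))"
      by (cases "card F = 0"; cases "sep_num f n \<epsilon> K = 0") auto
    with le have "real n * c \<le> ln (real (sep_num f n \<epsilon> K))"
      by simp
    then have "c \<le> 1 / real n * ln (real (sep_num f n \<epsilon> K))"
      using n by (simp add: field_simps)
    then show ?thesis
      using n by auto
  qed
  then have "ereal c \<le> sep_rate f \<epsilon> K"
    unfolding sep_rate_def
    by (metis (no_types, lifting) Limsup_lessD eventually_sequentially not_le)
  also have "\<dots> \<le> bowen_entropy f"
    using f K e by (rule sep_rate_le_bowen_entropy)
  finally show ?thesis .
qed

section \<open>Prescribing orbits that start near a specification point\<close>

text \<open>
  The definition of a specification point compares \<open>f ^^ i\<close> of both points at the same absolute
  time \<open>i\<close>.  Surjectivity turns this into prescribing the positions themselves: a target at time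
  \<open>t\<close> is replaced by one of its preimages under \<open>f ^^ t\<close>.
\<close>

lemma surj_funpow_preimage:
  fixes f :: "'a \<Rightarrow> 'a"
  assumes "surj f"
  obtains g where "\<And>n z. (f ^^ n) (g n z) = z"
proof -
  have "surj (f ^^ n)" for n
    by (rule surj_fn[OF assms])
  then have "(f ^^ n) (inv (f ^^ n) z) = z" for n z
    by (simp add: surj_f_inv_f)
  then show ?thesis
    using that[of "\<lambda>n. inv (f ^^ n)"] by blast
qed

text \<open>
  Specification with blocks consisting of a single time each, spaced as tightly as the gap
  permits; the targets \<open>v j\<close> are arbitrary, so they can spell a binary code.
\<close>

lemma specification_point_code:
  fixes f :: "'a::metric_space \<Rightarrow> 'a"
  assumes "surj f" and "specification_point f x" and "\<epsilon> > 0"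
  shows "\<exists>M>0. \<forall>L v. \<exists>z. \<forall>j\<in>{1..L}. dist ((f ^^ (j * M)) z) (v j) < \<epsilon>"
proof -
  obtain g where g: "\<And>n z. (f ^^ n) (g n z) = z"
    using surj_funpow_preimage[OF assms(1)] by blast
  obtain M where M: "M > 0" and spec: "\<And>(k::nat) u a b. k \<ge> 1 \<Longrightarrow> u 1 = x \<Longrightarrow>
      (\<forall>j\<in>{1..k}. a j \<le> b j) \<Longrightarrow>
      (\<forall>j\<in>{2..k}. b (j - 1) < a j \<and> a j - b (j - 1) \<ge> M) \<Longrightarrow>
      \<exists>y. \<forall>j\<in>{1..k}. \<forall>i\<in>{a j..b j}. dist ((f ^^ i) y) ((f ^^ i) (u j)) < \<epsilon>"
    using assms(2,3) unfolding specification_point_def by metis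
  have "\<exists>z. \<forall>j\<in>{1..L}. dist ((f ^^ (j * M)) z) (v j) < \<epsilon>" for L v
  proof -
    \<comment> \<open>Block \<open>1\<close> is the point \<open>x\<close> at time \<open>0\<close>, so the target \<open>v j\<close> belongs to block \<open>j + 1\<close>.\<close>
    define u where "u j = (if j = 1 then x else g ((j - 1) * M) (v (j - 1)))" for j :: nat
    define a where "a j = (j - 1) * M" for j :: nat
    have "a (j - 1) < a j \<and> a j - a (j - 1) \<ge> M" if "j \<in> {2..L + 1}" for j
    proof -
      obtain i where "j = Suc (Suc i)"
        using \<open>j \<in> _\<close> by (metis add_2_eq_Suc atLeastAtMost_iff le_Suc_ex)
      then show ?thesis
        using M by (simp add: a_def)
    qed
    then have "\<exists>z. \<forall>j\<in>{1..L + 1}. \<forall>i\<in>{a j..a j}. dist ((f ^^ i) z) ((f ^^ i) (u j)) < \<epsilon>"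
      by (intro spec ballI) (simp_all add: u_def)
    then obtain z where z: "\<And>j i. j \<in> {1..L + 1} \<Longrightarrow> i \<in> {a j..a j} \<Longrightarrow>
        dist ((f ^^ i) z) ((f ^^ i) (u j)) < \<epsilon>"
      by blast
    have "dist ((f ^^ (j * M)) z) (v j) < \<epsilon>" if "j \<in> {1..L}" for j
      using z[of "j + 1" "j * M"] that by (auto simp: a_def u_def g)
    then show ?thesis
      by blast
  qed
  with M show ?thesis
    by blast
qed

text \<open>
  Specification with two blocks: the point \<open>x\<close> at time \<open>0\<close> and, after one gap, an arbitrarily long
  piece of an arbitrary orbit.
\<close>

lemma specification_point_block:
  fixes f :: "'a::metric_space \<Rightarrow> 'a"
  assumes "surj f" and "specification_point f x" and "\<epsilon> > 0"
  shows "\<exists>M. \<forall>L w. \<exists>z. dist z x < \<epsilon> \<and> (\<forall>i\<le>L. dist ((f ^^ (M + i)) z) ((f ^^ i) w) < \<epsilon>)"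
proof -
  obtain g where g: "\<And>n z. (f ^^ n) (g n z) = z"
    using surj_funpow_preimage[OF assms(1)] by blast
  obtain M where M: "M > 0" and spec: "\<And>(k::nat) u a b. k \<ge> 1 \<Longrightarrow> u 1 = x \<Longrightarrow>
      (\<forall>j\<in>{1..k}. a j \<le> b j) \<Longrightarrow>
      (\<forall>j\<in>{2..k}. b (j - 1) < a j \<and> a j - b (j - 1) \<ge> M) \<Longrightarrow>
      \<exists>y. \<forall>j\<in>{1..k}. \<forall>i\<in>{a j..b j}. dist ((f ^^ i) y) ((f ^^ i) (u j)) < \<epsilon>"
    using assms(2,3) unfolding specification_point_def by metis
  have "\<exists>z. dist z x < \<epsilon> \<and> (\<forall>i\<le>L. dist ((f ^^ (M + i)) z) ((f ^^ i) w) < \<epsilon>)" for L w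
  proof -
    define u where "u j = (if j = 1 then x else g M w)" for j :: nat
    define a where "a j = (if j = 1 then 0 else M)" for j :: nat
    define b where "b j = (if j = 1 then 0 else M + L)" for j :: nat
    have "b (j - 1) < a j \<and> a j - b (j - 1) \<ge> M" if "j \<in> {2..2}" for j
      using that M by (auto simp: a_def b_def)
    moreover have "a j \<le> b j" for j
      by (simp add: a_def b_def)
    ultimately have "\<exists>z. \<forall>j\<in>{1..2}. \<forall>i\<in>{a j..b j}. dist ((f ^^ i) z) ((f ^^ i) (u j)) < \<epsilon>"
      by (intro spec ballI) (simp_all add: u_def)
    then obtain z where z: "\<And>j i. j \<in> {1..2} \<Longrightarrow> i \<in> {a j..b j} \<Longrightarrow>
        dist ((f ^^ i) z) ((f ^^ i) (u j)) < \<epsilon>"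
      by blast
    have "dist z x < \<epsilon>"
      using z[of 1 0] by (simp add: a_def b_def u_def)
    moreover have "dist ((f ^^ (M + i)) z) ((f ^^ i) w) < \<epsilon>" if "i \<le> L" for i
    proof -
      have "(f ^^ (M + i)) (g M w) = (f ^^ i) w"
        by (simp add: add.commute[of M] funpow_add g)
      then show ?thesis
        using z[of 2 "M + i"] that by (simp add: a_def b_def u_def)
    qed
    ultimately show ?thesis
      by blast
  qed
  then show ?thesis
    by blast
qed

section \<open>Exponentially many separated orbits starting close to a specification point\<close>

text \<open>
  The constants \<open>\<epsilon>\<close> and \<open>N\<close>, hence the growth rate \<open>ln 2 / N\<close>, are chosen before the radius
  \<open>\<delta>\<close>: the gap that depends on \<open>\<delta>\<close> occurs only once in each orbit and is absorbed by taking
  the code length \<open>L\<close> large.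
\<close>

lemma specification_point_separated_near:
  fixes f :: "'a::metric_space \<Rightarrow> 'a"
  assumes surj: "surj f" and x: "specification_point f x" and "x \<noteq> y"
  shows "\<exists>\<epsilon>>0. \<exists>N>0. \<forall>\<delta>>0. \<forall>m. \<exists>n L F. m \<le> n \<and> n \<le> N * L \<and> finite F \<and> card F = 2 ^ L
           \<and> separated f n \<epsilon> (ball x \<delta>) F"
proof -
  \<comment> \<open>Two shadowings, each with error \<open>e\<close>, move two codes towards each other by at most \<open>4 * e\<close>.\<close>
  define e where "e = dist x y / 8"
  have e: "e > 0"
    using \<open>x \<noteq> y\<close> by (simp add: e_def)
  obtain M where M: "M > 0"
    and code: "\<And>L v. \<exists>z. \<forall>j\<in>{1..L}. dist ((f ^^ (j * M)) z) (v j) < e"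
    using specification_point_code[OF surj x e] by blast
  have near: "\<exists>n L F. m \<le> n \<and> n \<le> (M + 1) * L \<and> finite F \<and> card F = 2 ^ L
      \<and> separated f n (4 * e) (ball x \<delta>) F" if "\<delta> > 0" for \<delta> m
  proof -
    have "min \<delta> e > 0"
      using \<open>\<delta> > 0\<close> e by simp
    from specification_point_block[OF surj x this] obtain G where
      block: "\<And>L w. \<exists>z. dist z x < min \<delta> e \<and>
                (\<forall>i\<le>L. dist ((f ^^ (G + i)) z) ((f ^^ i) w) < min \<delta> e)"
      by blast
    define L where "L = G + m + 1"
    define n where "n = G + L * M + 1"
    define target where "target S j = (if j \<in> S then x else y)" for S and j :: nat
    have "\<exists>z. dist z x < \<delta> \<and>
        (\<forall>j\<in>{1..L}. dist ((f ^^ (G + j * M)) z) (target S j) < 2 * e)" for S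
    proof -
      obtain w where w: "\<And>j. j \<in> {1..L} \<Longrightarrow> dist ((f ^^ (j * M)) w) (target S j) < e"
        using code by blast
      obtain z where z: "dist z x < min \<delta> e"
        "\<And>i. i \<le> L * M \<Longrightarrow> dist ((f ^^ (G + i)) z) ((f ^^ i) w) < min \<delta> e"
        using block by blast
      have "dist ((f ^^ (G + j * M)) z) (target S j) < 2 * e" if "j \<in> {1..L}" for j
      proof -
        have "dist ((f ^^ (G + j * M)) z) ((f ^^ (j * M)) w) < e"
          using z(2)[of "j * M"] that by simp
        then show ?thesis
          using w[OF that] dist_triangle[of "(f ^^ (G + j * M)) z" "target S j" "(f ^^ (j * M)) w"]
          by linarith
      qed
      then show ?thesis
        using z(1) by auto
    qed
    then obtain p where p_near: "\<And>S. dist (p S) x < \<delta>"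
      and p_code: "\<And>S j. j \<in> {1..L} \<Longrightarrow> dist ((f ^^ (G + j * M)) (p S)) (target S j) < 2 * e"
      by metis
    have sep: "bowen_dist f n (p S) (p T) > 4 * e"
      if ST: "S \<subseteq> {1..L}" "T \<subseteq> {1..L}" "S \<noteq> T" for S T
    proof -
      obtain j where j: "j \<in> {1..L}" "(j \<in> S) \<noteq> (j \<in> T)"
        using ST by blast
      have "dist (target S j) (target T j) = 8 * e"
        using j(2) by (auto simp: target_def e_def dist_commute)
      moreover have "dist (target S j) (target T j)
          \<le> dist ((f ^^ (G + j * M)) (p S)) (target S j)
            + dist ((f ^^ (G + j * M)) (p S)) ((f ^^ (G + j * M)) (p T))
            + dist ((f ^^ (G + j * M)) (p T)) (target T j)"
        using dist_triangle[of "target S j" "target T j" "(f ^^ (G + j * M)) (p S)"]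
          dist_triangle[of "(f ^^ (G + j * M)) (p S)" "target T j" "(f ^^ (G + j * M)) (p T)"]
        by (simp add: dist_commute)
      ultimately have "dist ((f ^^ (G + j * M)) (p S)) ((f ^^ (G + j * M)) (p T)) > 4 * e"
        using p_code[OF j(1), of S] p_code[OF j(1), of T] by linarith
      moreover have "G + j * M \<le> n - 1"
        using j(1) by (simp add: n_def)
      ultimately show ?thesis
        unfolding bowen_dist_gt_iff by blast
    qed
    \<comment> \<open>Separation also makes the coding injective, because a point has distance \<open>0\<close> to itself.\<close>
    have self: "\<not> bowen_dist f n z z > 4 * e" for z
      using e by (simp add: bowen_dist_gt_iff)
    have "inj_on p (Pow {1..L})"
      by (rule inj_onI) (metis Pow_iff sep self)
    then have "card (p ` Pow {1..L}) = 2 ^ L"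
      by (simp add: card_image card_Pow)
    moreover have "separated f n (4 * e) (ball x \<delta>) (p ` Pow {1..L})"
      using p_near sep by (auto simp: separated_def dist_commute)
    moreover have "n \<le> (M + 1) * L"
      by (simp add: n_def L_def algebra_simps)
    moreover have "m \<le> n"
    proof -
      have "L \<le> L * M"
        using M by simp
      then show ?thesis
        unfolding n_def L_def by linarith
    qed
    moreover have "finite (p ` Pow {1..L})"
      by simp
    ultimately show ?thesis
      by blast
  qed
  show ?thesis
    by (rule exI[of _ "4 * e"], rule conjI, use e in simp, rule exI[of _ "M + 1"])
      (use near in simp)
qed

section \<open>Positive entropy\<close>

lemma bowen_entropy_pos_of_specification_point:
  fixes f :: "'a::metric_space \<Rightarrow> 'a"
  assumes f: "continuous_on UNIV f" and surj: "surj f"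
    and x: "specification_point f x" and "x \<noteq> y"
  shows "bowen_entropy f > 0"
proof -
  obtain \<epsilon> N where e: "\<epsilon> > 0" and N: "N > 0"
    and near: "\<And>\<delta> m. \<delta> > 0 \<Longrightarrow> \<exists>n L F. m \<le> n \<and> n \<le> N * L \<and> finite F \<and> card F = 2 ^ L
           \<and> separated f n \<epsilon> (ball x \<delta>) F"
    using specification_point_separated_near[OF surj x \<open>x \<noteq> y\<close>] by metis
  have "\<exists>n L F. Suc k \<le> n \<and> n \<le> N * L \<and> finite F \<and> card F = 2 ^ L
      \<and> separated f n \<epsilon> (ball x (inverse (real (Suc k)))) F" for k
    by (rule near) simp
  then obtain n L F where nk: "\<And>k. Suc k \<le> n k" and nL: "\<And>k. n k \<le> N * L k"
    and fin: "\<And>k. finite (F k)" and card: "\<And>k. card (F k) = 2 ^ L k"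
    and sep: "\<And>k. separated f (n k) \<epsilon> (ball x (inverse (real (Suc k)))) (F k)"
    by metis
  define K where "K = insert x (\<Union>k. F k)"
  have "compact K"
    unfolding K_def
  proof (rule compact_insert_shrinking[OF fin])
    fix r :: real assume "r > 0"
    have "\<forall>\<^sub>F k in sequentially. inverse (real (Suc k)) < r"
      using LIMSEQ_inverse_real_of_nat \<open>r > 0\<close> by (rule order_tendstoD)
    then show "\<forall>\<^sub>F k in sequentially. F k \<subseteq> ball x r"
      by eventually_elim (use sep in \<open>force simp: separated_def\<close>)
  qed
  have "ereal (ln 2 / real N) \<le> bowen_entropy f"
  proof (rule bowen_entropy_ge[OF f \<open>compact K\<close> e])
    fix m
    have "real (n m) \<le> real N * real (L m)"
      using nL[of m] by (metis of_nat_le_iff of_nat_mult)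
    then have "real (n m) / real N \<le> real (L m)"
      using N by (simp add: field_simps)
    from mult_right_mono[OF this, of "ln 2"]
    have "real (n m) * (ln 2 / real N) \<le> ln (real (card (F m)))"
      by (simp add: card ln_realpow)
    moreover have "separated f (n m) \<epsilon> K (F m)"
      using sep[of m] by (auto simp: separated_def K_def)
    ultimately show "\<exists>n\<ge>m. \<exists>F. n > 0 \<and> separated f n \<epsilon> K F
        \<and> real n * (ln 2 / real N) \<le> ln (real (card F))"
      using nk[of m] by (intro exI[of _ "n m"] conjI exI[of _ "F m"]) auto
  qed
  moreover have "ereal (ln 2 / real N) > 0"
    using N by simp
  ultimately show ?thesis
    by (rule less_le_trans[rotated])
qed

theorem theorem4p13:
  fixes f :: "'a::metric_space \<Rightarrow> 'a"
  assumes "uniformly_continuous_on UNIV f"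
    and "surj f"
    and "\<exists>x y. x \<noteq> y \<and> specification_point f x \<and> specification_point f y"
  shows "bowen_entropy f > 0"
  using assms bowen_entropy_pos_of_specification_point uniformly_continuous_imp_continuous
  by metis

end
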